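(* Let $(S,\cdot)$ be a semigroup satisfying the Strong F\o lner Condition and let $A\subseteq S$. Then $d(A)=\max\{\nu(\chi_A):\nu\in LIM_0(S)\}$.
   Context: ${\mathcal P}_f(S)$ is the set of finite nonempty subsets of $S$. $S$ satisfies the Strong F\o lner Condition if for every $H\in{\mathcal P}_f(S)$, $\epsilon>0$ there is $K\in{\mathcal P}_f(S)$ with $|K\setminus sK|<\epsilon|K|$ for all $s\in H$. $d(A)$ is the supremum of $\alpha\in[0,1]$ such that for every $H\in{\mathcal P}_f(S)$, $\epsilon>0$ there is $K\in{\mathcal P}_f(S)$ with $|K\setminus sK|<\epsilon|K|$ for all $s\in H$ and $|A\cap K|\ge\alpha|K|$. A F\o lner net is a net $\langle F_\alpha\rangle_{\alpha\in D}$ in ${\mathcal P}_f(S)$ with $\lim_\alpha|F_\alpha\setminus sF_\alpha|/|F_\alpha|=0$ for every $s\in S$. For $F\in{\mathcal P}_f(S)$, $\mu_F(g)=\frac1{|F|}\sum_{t\in F}g(t)$ for bounded real $g$ on $S$. $LIM_0(S)$ is the set of all cluster points, in the weak* topology of $l_\infty(S)^*$ (pointwise convergence on $l_\infty(S)$), of nets $\langle\mu_{F_\alpha}\rangle_{\alpha\in D}$ where $\langle F_\alpha\rangle_{\alpha\in D}$ is a F\o lner net. *)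

theory Defs
  imports "HOL-Analysis.Analysis" "HOL-Probability.Discrete_Topology"
begin

section \<open>Folner condition and density\<close>

text \<open>The semigroup \<open>S\<close> is a type \<open>'a\<close> of class \<^class>\<open>semigroup_mult\<close>; in particular it is nonempty.
  The left translate \<open>sK\<close> is the image \<open>(*) s ` K\<close>.\<close>

definition Pf :: "'a set set" where
  "Pf = {K. finite K \<and> K \<noteq> {}}"

definition SFC :: "'a::semigroup_mult itself \<Rightarrow> bool" where
  "SFC _ \<longleftrightarrow> (\<forall>H \<in> (Pf :: 'a set set). \<forall>\<epsilon>::real. \<epsilon> > 0 \<longrightarrow>
     (\<exists>K \<in> Pf. \<forall>s \<in> H. real (card (K - (*) s ` K)) < \<epsilon> * real (card K)))"

definition folner_density :: "'a::semigroup_mult set \<Rightarrow> real" where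
  "folner_density A = Sup {\<alpha> :: real. 0 \<le> \<alpha> \<and> \<alpha> \<le> 1 \<and>
     (\<forall>H \<in> Pf. \<forall>\<epsilon>::real. \<epsilon> > 0 \<longrightarrow>
       (\<exists>K \<in> Pf. (\<forall>s \<in> H. real (card (K - (*) s ` K)) < \<epsilon> * real (card K)) \<and>
          real (card (A \<inter> K)) \<ge> \<alpha> * real (card K)))}"

section \<open>Nets\<close>

definition directed_set :: "'i set \<Rightarrow> ('i \<Rightarrow> 'i \<Rightarrow> bool) \<Rightarrow> bool" where
  "directed_set D le \<longleftrightarrow> D \<noteq> {} \<and>
     (\<forall>a\<in>D. le a a) \<and>
     (\<forall>a\<in>D. \<forall>b\<in>D. \<forall>c\<in>D. le a b \<longrightarrow> le b c \<longrightarrow> le a c) \<and>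
     (\<forall>a\<in>D. \<forall>b\<in>D. \<exists>c\<in>D. le a c \<and> le b c)"

definition tails :: "'i set \<Rightarrow> ('i \<Rightarrow> 'i \<Rightarrow> bool) \<Rightarrow> 'i filter" where
  "tails D le = (INF a\<in>D. principal {b\<in>D. le a b})"

lemma eventually_tails:
  assumes "directed_set D le"
  shows "eventually P (tails D le) \<longleftrightarrow> (\<exists>a\<in>D. \<forall>b\<in>D. le a b \<longrightarrow> P b)"
proof -
  have "eventually P (tails D le) \<longleftrightarrow> (\<exists>a\<in>D. eventually P (principal {b\<in>D. le a b}))"
    unfolding tails_def
  proof (rule eventually_INF_base)
    show "D \<noteq> {}" using assms by (simp add: directed_set_def)
  next
    fix a b assume ab: "a \<in> D" "b \<in> D"
    then obtain c where c: "c \<in> D" "le a c" "le b c"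
      using assms unfolding directed_set_def by meson
    have tr: "le x z" if "x \<in> D" "y \<in> D" "z \<in> D" "le x y" "le y z" for x y z
      using assms that unfolding directed_set_def by meson
    have "{x \<in> D. le c x} \<subseteq> {x \<in> D. le a x} \<inter> {x \<in> D. le b x}"
      using tr[OF ab(1) c(1) _ c(2)] tr[OF ab(2) c(1) _ c(3)] by auto
    then show "\<exists>x\<in>D. principal {b \<in> D. le x b} \<le>
        inf (principal {b \<in> D. le a b}) (principal {x \<in> D. le b x})"
      using c by auto
  qed
  then show ?thesis by (auto simp: eventually_principal)
qed

lemma frequently_tails:
  assumes "directed_set D le"
  shows "frequently P (tails D le) \<longleftrightarrow> (\<forall>a\<in>D. \<exists>b\<in>D. le a b \<and> P b)"
  using eventually_tails[OF assms, of "\<lambda>x. \<not> P x"] by (auto simp: frequently_def)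

definition folner_net ::
    "'i set \<Rightarrow> ('i \<Rightarrow> 'i \<Rightarrow> bool) \<Rightarrow> ('i \<Rightarrow> 'a::semigroup_mult set) \<Rightarrow> bool" where
  "folner_net D le F \<longleftrightarrow> directed_set D le \<and> (\<forall>\<alpha>\<in>D. F \<alpha> \<in> Pf) \<and>
     (\<forall>s. ((\<lambda>\<alpha>. real (card (F \<alpha> - (*) s ` F \<alpha>)) / real (card (F \<alpha>))) \<longlongrightarrow> 0) (tails D le))"

definition cluster_point_of_net ::
    "'b topology \<Rightarrow> 'i set \<Rightarrow> ('i \<Rightarrow> 'i \<Rightarrow> bool) \<Rightarrow> ('i \<Rightarrow> 'b) \<Rightarrow> 'b \<Rightarrow> bool" where
  "cluster_point_of_net T D le x p \<longleftrightarrow> p \<in> topspace T \<and>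
     (\<forall>U. openin T U \<longrightarrow> p \<in> U \<longrightarrow> (\<forall>\<alpha>\<in>D. \<exists>\<beta>\<in>D. le \<alpha> \<beta> \<and> x \<beta> \<in> U))"

section \<open>Bounded functions, their dual, and the means given by finite sets\<close>

text \<open>Every function on a discrete space is continuous, so the Banach space of bounded continuous
  functions on \<open>'a discrete\<close> is all of \<open>l\<^sub>\<infinity>(S)\<close> with the sup norm.\<close>

type_synonym 'a linf = "('a discrete, real) bcontfun"

lemma bcontfun_discrete_iff:
  "(f :: 'a discrete \<Rightarrow> real) \<in> bcontfun \<longleftrightarrow> bounded (range f)"
  by (simp add: bcontfun_def continuous_on_open_vimage open_discrete)

text \<open>On bounded linear maps into \<^typ>\<open>real\<close>, the strong operator topology is the topology of
  pointwise convergence on \<open>l\<^sub>\<infinity>(S)\<close>, i.e. the weak* topology of the dual.\<close>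

type_synonym 'a linf_dual = "'a linf \<Rightarrow>\<^sub>L real"

abbreviation weak_star_topology :: "'a linf_dual topology" where
  "weak_star_topology \<equiv> strong_operator_topology"

definition chi :: "'a set \<Rightarrow> 'a linf" where
  "chi A = Bcontfun (\<lambda>x. indicator A (of_discrete x))"

lemma apply_chi [simp]: "apply_bcontfun (chi A) x = indicator A (of_discrete x)"
proof -
  have "bounded (range (\<lambda>x. indicator A (of_discrete x) :: real))"
    by (rule boundedI[where B = 1]) (auto simp: indicator_def)
  then show ?thesis
    unfolding chi_def by (subst Bcontfun_inverse) (simp_all add: bcontfun_discrete_iff)
qed

definition mean :: "'a set \<Rightarrow> 'a linf_dual" where
  "mean F = Blinfun (\<lambda>g. (1 / real (card F)) * (\<Sum>t\<in>F. apply_bcontfun g (discrete t)))"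

lemma bounded_linear_mean:
  "bounded_linear (\<lambda>g :: 'a linf. (1 / real (card F)) * (\<Sum>t\<in>F. apply_bcontfun g (discrete t)))"
proof (rule bounded_linear_intro[where K = 1])
  fix g :: "'a linf"
  have "norm (\<Sum>t\<in>F. apply_bcontfun g (discrete t)) \<le> (\<Sum>t\<in>F. norm g)"
    by (rule sum_norm_le) (rule norm_bounded)
  then have "\<bar>\<Sum>t\<in>F. apply_bcontfun g (discrete t)\<bar> \<le> real (card F) * norm g"
    by simp
  then show "norm ((1 / real (card F)) * (\<Sum>t\<in>F. apply_bcontfun g (discrete t))) \<le> norm g * 1"
    by (cases "card F = 0") (simp_all add: abs_mult field_simps)
next
  fix g h :: "'a linf" and r :: real
  show "(1 / real (card F)) * (\<Sum>t\<in>F. apply_bcontfun (g + h) (discrete t)) =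
      (1 / real (card F)) * (\<Sum>t\<in>F. apply_bcontfun g (discrete t)) +
      (1 / real (card F)) * (\<Sum>t\<in>F. apply_bcontfun h (discrete t))"
    by (simp add: plus_bcontfun.rep_eq sum.distrib distrib_left add_divide_distrib)
  show "(1 / real (card F)) * (\<Sum>t\<in>F. apply_bcontfun (r *\<^sub>R g) (discrete t)) =
      r *\<^sub>R ((1 / real (card F)) * (\<Sum>t\<in>F. apply_bcontfun g (discrete t)))"
    by (simp add: scaleR_bcontfun.rep_eq flip: sum_distrib_left)
qed

lemma mean_apply:
  "blinfun_apply (mean F) g = (1 / real (card F)) * (\<Sum>t\<in>F. apply_bcontfun g (discrete t))"
  unfolding mean_def by (subst bounded_linear_Blinfun_apply[OF bounded_linear_mean]) (rule refl)

section \<open>The set \<open>LIM\<^sub>0(S)\<close>\<close>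

definition LIM0_on :: "'i itself \<Rightarrow> ('a::semigroup_mult) linf_dual set" where
  "LIM0_on _ = {\<nu>. \<exists>(D :: 'i set) le F. folner_net D le F \<and>
     cluster_point_of_net weak_star_topology D le (\<lambda>\<alpha>. mean (F \<alpha>)) \<nu>}"

text \<open>\<open>LIM\<^sub>0(S)\<close> ranges over nets with arbitrary index sets, and one cannot quantify over the type
  of the indices. The index type used here suffices: by the lemma \<open>LIM0_on_subset_LIM0\<close> below,
  index sets of any other type contribute no further functionals.\<close>

definition LIM0 :: "('a::semigroup_mult) linf_dual set" where
  "LIM0 = LIM0_on TYPE('a set set \<times> 'a set)"

lemma cluster_point_of_net_iff_filter:
  assumes "directed_set D le"
  shows "cluster_point_of_net T D le x p \<longleftrightarrow> p \<in> topspace T \<and>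
     (\<forall>U. openin T U \<longrightarrow> p \<in> U \<longrightarrow> frequently (\<lambda>y. y \<in> U) (filtermap x (tails D le)))"
  by (simp add: cluster_point_of_net_def frequently_filtermap frequently_tails[OF assms])

lemma LIM0_on_subset_LIM0:
  "(LIM0_on TYPE('i) :: ('a::semigroup_mult) linf_dual set) \<subseteq> LIM0"
proof
  fix \<nu> :: "'a linf_dual"
  assume "\<nu> \<in> LIM0_on TYPE('i)"
  then obtain D :: "'i set" and le F where fn: "folner_net D le F"
    and cl: "cluster_point_of_net weak_star_topology D le (\<lambda>\<alpha>. mean (F \<alpha>)) \<nu>"
    by (auto simp: LIM0_on_def)
  have dir: "directed_set D le" and FPf: "\<And>\<alpha>. \<alpha> \<in> D \<Longrightarrow> F \<alpha> \<in> Pf"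
    using fn by (auto simp: folner_net_def)
  define \<Phi> where "\<Phi> = filtermap F (tails D le)"
  have D_ne: "D \<noteq> {}" using dir by (simp add: directed_set_def)
  have evD: "eventually (\<lambda>a. a \<in> D) (tails D le)"
    using D_ne by (auto simp: eventually_tails[OF dir])
  have Phi_Pf: "eventually (\<lambda>K. K \<in> Pf) \<Phi>"
    unfolding \<Phi>_def eventually_filtermap by (rule eventually_mono[OF evD]) (rule FPf)
  have ev_ne: "\<exists>x. P x" if "eventually P \<Phi>" for P
  proof -
    from that obtain a where "a \<in> D" "\<forall>b\<in>D. le a b \<longrightarrow> P (F b)"
      by (auto simp: \<Phi>_def eventually_filtermap eventually_tails[OF dir])
    moreover have "le a a" using \<open>a \<in> D\<close> dir by (simp add: directed_set_def)
    ultimately show ?thesis by blast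
  qed
  define E where "E = {(B :: 'a set set, x). x \<in> B \<and> B \<subseteq> Pf \<and> eventually (\<lambda>K. K \<in> B) \<Phi>}"
  define le' where "le' = (\<lambda>(p :: 'a set set \<times> 'a set) (q :: 'a set set \<times> 'a set). fst q \<subseteq> fst p)"
  have Pf_ev: "eventually (\<lambda>K. K \<in> {K. K \<in> Pf \<and> P K}) \<Phi>" if "eventually P \<Phi>" for P
    using eventually_conj[OF Phi_Pf that] by simp
  have E_ex: "\<exists>x. (B, x) \<in> E" if "B \<subseteq> Pf" "eventually (\<lambda>K. K \<in> B) \<Phi>" for B
    using ev_ne[OF that(2)] that by (auto simp: E_def)
  have dirE: "directed_set E le'"
    unfolding directed_set_def
  proof (intro conjI ballI impI)
    show "E \<noteq> {}" using E_ex[of Pf] Phi_Pf by auto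
  next
    fix a b assume "a \<in> E" "b \<in> E"
    then have "fst a \<inter> fst b \<subseteq> Pf" "eventually (\<lambda>K. K \<in> fst a \<inter> fst b) \<Phi>"
      by (auto simp: E_def eventually_conj)
    from E_ex[OF this] obtain x where "(fst a \<inter> fst b, x) \<in> E" ..
    then show "\<exists>c\<in>E. le' a c \<and> le' b c"
      by (intro bexI[where x = "(fst a \<inter> fst b, x)"]) (auto simp: le'_def)
  qed (auto simp: le'_def)
  have ev_iff: "eventually P (filtermap snd (tails E le')) \<longleftrightarrow> eventually P \<Phi>" for P
  proof
    assume "eventually P (filtermap snd (tails E le'))"
    then obtain B x where a: "(B, x) \<in> E" "\<forall>b\<in>E. le' (B, x) b \<longrightarrow> P (snd b)"
      by (auto simp: eventually_filtermap eventually_tails[OF dirE])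
    have "P y" if "y \<in> B" for y
    proof -
      have "(B, y) \<in> E" using a(1) that by (auto simp: E_def)
      then show ?thesis using a(2) by (force simp: le'_def)
    qed
    moreover have "eventually (\<lambda>K. K \<in> B) \<Phi>" using a(1) by (simp add: E_def)
    ultimately show "eventually P \<Phi>" by (rule eventually_mono[rotated])
  next
    assume "eventually P \<Phi>"
    from Pf_ev[OF this] obtain x where x: "({K. K \<in> Pf \<and> P K}, x) \<in> E"
      using E_ex[of "{K. K \<in> Pf \<and> P K}"] by auto
    show "eventually P (filtermap snd (tails E le'))"
      unfolding eventually_filtermap eventually_tails[OF dirE]
      by (intro bexI[OF _ x]) (auto simp: le'_def E_def)
  qed
  then have eq: "filtermap snd (tails E le') = \<Phi>"
    by (simp add: filter_eq_iff)
  have fm: "filtermap g (filtermap snd (tails E le')) = filtermap g (filtermap F (tails D le))"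
    for g :: "'a set \<Rightarrow> 'z"
    by (simp only: eq \<Phi>_def)
  have "folner_net E le' snd"
    unfolding folner_net_def
  proof (intro conjI allI ballI)
    show "directed_set E le'" by (rule dirE)
    show "snd \<alpha> \<in> Pf" if "\<alpha> \<in> E" for \<alpha> using that by (auto simp: E_def)
    fix s :: 'a
    have "((\<lambda>\<alpha>. real (card (F \<alpha> - (*) s ` F \<alpha>)) / real (card (F \<alpha>))) \<longlongrightarrow> 0) (tails D le)"
      using fn by (simp add: folner_net_def)
    then show "((\<lambda>\<alpha>. real (card (snd \<alpha> - (*) s ` snd \<alpha>)) / real (card (snd \<alpha>))) \<longlongrightarrow> 0) (tails E le')"
      using fm[of "\<lambda>K. real (card (K - (*) s ` K)) / real (card K)"]
      by (simp add: filterlim_def filtermap_filtermap)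
  qed
  moreover have "cluster_point_of_net weak_star_topology E le' (\<lambda>\<alpha>. mean (snd \<alpha>)) \<nu>"
    using cl fm[of mean]
    by (simp add: cluster_point_of_net_iff_filter[OF dir] cluster_point_of_net_iff_filter[OF dirE]
        filtermap_filtermap)
  ultimately show "\<nu> \<in> LIM0"
    unfolding LIM0_def LIM0_on_def by blast
qed

end

theory Submission
  imports Defs
begin

text \<open>The Folner sets witnessing that \<open>d(A)\<close> is approached form a Folner net, indexed by the
  requirements \<open>(H, n)\<close>; its means lie in the unit ball of the dual, which is pointwise compact, so
  they have a cluster point, whose value at \<open>\<chi>\<^sub>A\<close> is at least \<open>d(A)\<close>. Conversely, if \<open>\<nu>\<close> is a
  cluster point of means along a Folner net, then sets of that net that are arbitrarily far out
  witness every \<open>\<alpha> < \<nu>(\<chi>\<^sub>A)\<close>.\<close>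

section \<open>Weak* cluster points in the dual unit ball\<close>

text \<open>Banach-Alaoglu inside a product space: the bound confines each \<open>f x\<close> to a
  compact interval, so Tychonoff applies, and linearity cuts out a closed set because coordinate
  evaluations are continuous.\<close>

lemma compact_linear_norm_le:
  "compact {f :: 'v::real_normed_vector \<Rightarrow> real. linear f \<and> (\<forall>x. \<bar>f x\<bar> \<le> norm x)}"
proof -
  let ?B = "PiE UNIV (\<lambda>x :: 'v. {- norm x .. norm x})"
  have "compactin (product_topology (\<lambda>x. euclidean) UNIV) ?B"
    by (subst compactin_PiE) auto
  then have B: "compact ?B"
    by (simp add: euclidean_product_topology)
  have ev: "continuous_on UNIV (\<lambda>f :: 'v \<Rightarrow> real. f x)" for x
    by (rule continuous_on_product_coordinates)
  have add: "closed {f :: 'v \<Rightarrow> real. \<forall>x y. f (x + y) = f x + f y}"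
    by (intro closed_Collect_all closed_Collect_eq continuous_on_add ev)
  have scale: "closed {f :: 'v \<Rightarrow> real. \<forall>r x. f (r *\<^sub>R x) = r * f x}"
    by (intro closed_Collect_all closed_Collect_eq continuous_on_mult continuous_on_const ev)
  have "{f :: 'v \<Rightarrow> real. linear f \<and> (\<forall>x. \<bar>f x\<bar> \<le> norm x)} =
      ?B \<inter> {f. \<forall>x y. f (x + y) = f x + f y} \<inter> {f. \<forall>r x. f (r *\<^sub>R x) = r * f x}"
    by (auto simp: linear_iff abs_le_iff PiE_iff minus_le_iff)
  then show ?thesis
    using compact_Int_closed[OF compact_Int_closed[OF B add] scale] by simp
qed

text \<open>Through \<open>blinfun_apply\<close> the net becomes a filter \<open>G\<close>
  concentrated on the compact set \<open>C\<close>. A cluster point \<open>f\<close> of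
  \<open>G\<close> in \<open>C\<close> is linear and bounded, hence lifts back to the dual.\<close>

lemma cluster_point_of_net_ex:
  fixes x :: "'i \<Rightarrow> 'v::real_normed_vector \<Rightarrow>\<^sub>L real"
  assumes dir: "directed_set D le"
    and bd: "\<And>a g. a \<in> D \<Longrightarrow> \<bar>blinfun_apply (x a) g\<bar> \<le> norm g"
  obtains \<nu> where "cluster_point_of_net strong_operator_topology D le x \<nu>"
proof -
  define C where "C = {f :: 'v \<Rightarrow> real. linear f \<and> (\<forall>x. \<bar>f x\<bar> \<le> norm x)}"
  define G where "G = filtermap (\<lambda>a. blinfun_apply (x a)) (tails D le)"
  have G: "eventually P G \<longleftrightarrow> (\<exists>a\<in>D. \<forall>b\<in>D. le a b \<longrightarrow> P (blinfun_apply (x b)))" for P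
    by (simp add: G_def eventually_filtermap eventually_tails[OF dir])
  obtain a where a: "a \<in> D"
    using dir by (auto simp: directed_set_def)
  have refl: "le b b" if "b \<in> D" for b
    using dir that by (simp add: directed_set_def)
  \<comment> \<open>By reflexivity every tail contains its own starting index.\<close>
  have "G \<noteq> bot"
    unfolding trivial_limit_def G using refl by blast
  moreover have "blinfun_apply (x b) \<in> C" if "b \<in> D" for b
    unfolding C_def using bd[OF that]
    by (simp add: bounded_linear.linear[OF blinfun.bounded_linear_right])
  then have "eventually (\<lambda>f. f \<in> C) G"
    unfolding G using a by blast
  ultimately obtain f where f: "f \<in> C" "inf (nhds f) G \<noteq> bot"
    using compact_filter[THEN iffD1, rule_format, OF compact_linear_norm_le[where 'v = 'v], of G]
    unfolding C_def[symmetric] by blast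
  have "bounded_linear f"
    using f(1) by (intro bounded_linear_intro[where K = 1]) (auto simp: C_def linear_iff)
  then have \<nu>: "blinfun_apply (Blinfun f) = f"
    by (rule bounded_linear_Blinfun_apply)
  have "cluster_point_of_net strong_operator_topology D le x (Blinfun f)"
    unfolding cluster_point_of_net_iff_filter[OF dir]
  proof (intro conjI allI impI)
    show "Blinfun f \<in> topspace strong_operator_topology"
      by (simp add: strong_operator_topology_topspace)
    fix U assume "openin strong_operator_topology U" "Blinfun f \<in> U"
    \<comment> \<open>The strong operator topology is the pullback of the product topology along
      \<open>blinfun_apply\<close>, so its open sets are preimages.\<close>
    then obtain V where V: "open V" "U = blinfun_apply -` V" "f \<in> V"
      using \<nu> by (auto simp: strong_operator_topology_def openin_pullback_topology)
    \<comment> \<open>Otherwise \<open>G\<close> would eventually avoid the neighbourhood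
      \<open>V\<close> of \<open>f\<close>, making \<open>inf (nhds f) G\<close> trivial.\<close>
    have "frequently (\<lambda>h. h \<in> V) G"
    proof (rule ccontr)
      assume "\<not> frequently (\<lambda>h. h \<in> V) G"
      then have "eventually (\<lambda>h. h \<notin> V) G"
        by (simp add: frequently_def)
      with eventually_nhds_in_open[OF V(1,3)] have "eventually (\<lambda>_. False) (inf (nhds f) G)"
        unfolding eventually_inf by (intro exI conjI) auto
      with f(2) show False
        by (simp add: trivial_limit_def)
    qed
    then show "frequently (\<lambda>y. y \<in> U) (filtermap x (tails D le))"
      by (simp add: G_def V(2) frequently_filtermap)
  qed
  then show thesis ..
qed

text \<open>Evaluation at \<open>g\<close> is weak* continuous, so cluster points of functionals
  pass to the real values at \<open>g\<close>.\<close>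

lemma cluster_point_of_net_apply:
  assumes "cluster_point_of_net strong_operator_topology D le x \<nu>"
    and "open W" "blinfun_apply \<nu> g \<in> W" "a \<in> D"
  obtains b where "b \<in> D" "le a b" "blinfun_apply (x b) g \<in> W"
proof -
  let ?U = "{f \<in> topspace strong_operator_topology. blinfun_apply f g \<in> W}"
  have "openin strong_operator_topology ?U"
    by (rule openin_continuous_map_preimage[OF strong_operator_topology_continuous_evaluation])
      (use assms(2) in simp)
  moreover have "\<nu> \<in> ?U"
    using assms by (simp add: strong_operator_topology_topspace)
  ultimately show thesis
    using assms(1,4) that unfolding cluster_point_of_net_def by blast
qed

lemma mean_chi: "finite F \<Longrightarrow> blinfun_apply (mean F) (chi A) = real (card (A \<inter> F)) / real (card F)"
  using Indicator_Function.sum_indicator_mult[of F A "\<lambda>_. 1 :: real"]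
  by (simp add: mean_apply discrete_inverse Int_commute)

lemma abs_mean_le: "\<bar>blinfun_apply (mean F) g\<bar> \<le> norm g"
proof -
  have "\<bar>\<Sum>t\<in>F. apply_bcontfun g (discrete t)\<bar> \<le> (\<Sum>t\<in>F. norm g)"
    by (rule order_trans[OF sum_abs sum_mono]) (metis norm_bounded real_norm_def)
  \<comment> \<open>When \<open>card F = 0\<close> (empty or infinite \<open>F\<close>), division by
    zero makes the mean the zero functional.\<close>
  then show ?thesis
    by (cases "card F = 0") (simp_all add: mean_apply abs_mult field_simps)
qed

section \<open>Levels of the density and tails of Folner nets\<close>

text \<open>The level \<alpha> is left free of the range [0,1], since below it is taken slightly
  under the density and may be negative.\<close>

definition density_level :: "'a::semigroup_mult set \<Rightarrow> real \<Rightarrow> bool" where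
  "density_level A \<alpha> \<longleftrightarrow> (\<forall>H \<in> Pf. \<forall>\<epsilon>::real. \<epsilon> > 0 \<longrightarrow>
     (\<exists>K \<in> Pf. (\<forall>s \<in> H. real (card (K - (*) s ` K)) < \<epsilon> * real (card K)) \<and>
        real (card (A \<inter> K)) \<ge> \<alpha> * real (card K)))"

lemma folner_density_eq:
  "folner_density A = Sup {\<alpha>. 0 \<le> \<alpha> \<and> \<alpha> \<le> 1 \<and> density_level A \<alpha>}"
  by (simp add: folner_density_def density_level_def)

lemma le_folner_density:
  assumes "0 \<le> \<alpha>" "\<alpha> \<le> 1" "density_level A \<alpha>"
  shows "\<alpha> \<le> folner_density A"
  unfolding folner_density_eq by (rule cSup_upper) (use assms in auto)

text \<open>At level 0 the condition on \<open>A \<inter> K\<close> is void and what remains is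
  exactly the Strong Folner Condition.\<close>

lemma folner_density_nonneg:
  fixes A :: "'a::semigroup_mult set"
  assumes "SFC TYPE('a)"
  shows "0 \<le> folner_density A"
  using assms by (intro le_folner_density) (auto simp: density_level_def SFC_def)

text \<open>Levels are closed downwards, and level 0 makes the set under the supremum nonempty, so
  some level above \<alpha> is attained.\<close>

lemma density_level_less_folner_density:
  fixes A :: "'a::semigroup_mult set"
  assumes "SFC TYPE('a)" "\<alpha> < folner_density A"
  shows "density_level A \<alpha>"
proof -
  have "{\<alpha>. 0 \<le> \<alpha> \<and> \<alpha> \<le> 1 \<and> density_level A \<alpha>} \<noteq> {}"
    using assms(1) by (auto intro!: exI[where x = 0] simp: density_level_def SFC_def)
  then obtain \<beta> where \<beta>: "density_level A \<beta>" "\<alpha> < \<beta>"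
    using less_cSupE[OF assms(2)[unfolded folner_density_eq]] by auto
  have "\<alpha> * real (card K) \<le> \<beta> * real (card K)" for K :: "'a set"
    using \<beta>(2) by (intro mult_right_mono) auto
  with \<beta>(1) show ?thesis
    unfolding density_level_def by (meson order_trans)
qed

text \<open>Finitely many convergence statements, one for each \<open>s\<close> in \<open>H\<close>,
  hold together on one tail.\<close>

lemma folner_net_eventually:
  assumes fn: "folner_net D le F" and "finite H" and "\<epsilon> > 0"
  obtains a where "a \<in> D"
    "\<And>b s. b \<in> D \<Longrightarrow> le a b \<Longrightarrow> s \<in> H \<Longrightarrow> real (card (F b - (*) s ` F b)) < \<epsilon> * real (card (F b))"
proof -
  have dir: "directed_set D le" and F: "\<And>b. b \<in> D \<Longrightarrow> F b \<in> Pf"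
    using fn by (auto simp: folner_net_def)
  have "eventually (\<lambda>b. real (card (F b - (*) s ` F b)) / real (card (F b)) < \<epsilon>) (tails D le)" for s
    using fn \<open>\<epsilon> > 0\<close> by (intro order_tendstoD(2)[where y = 0]) (auto simp: folner_net_def)
  then have "eventually (\<lambda>b. \<forall>s\<in>H. real (card (F b - (*) s ` F b)) / real (card (F b)) < \<epsilon>) (tails D le)"
    by (simp add: eventually_ball_finite \<open>finite H\<close>)
  then obtain a where a: "a \<in> D"
    "\<forall>b\<in>D. le a b \<longrightarrow> (\<forall>s\<in>H. real (card (F b - (*) s ` F b)) / real (card (F b)) < \<epsilon>)"
    unfolding eventually_tails[OF dir] by blast
  have "card (F b) > 0" if "b \<in> D" for b
    using F[OF that] by (auto simp: Pf_def card_gt_0_iff)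
  with a show thesis
    by (intro that[of a]) (auto simp: pos_divide_less_eq)
qed

section \<open>The two inequalities and the maximum\<close>

lemma LIM0_chi_le:
  fixes A :: "'a::semigroup_mult set"
  assumes "SFC TYPE('a)" and "\<nu> \<in> LIM0"
  shows "blinfun_apply \<nu> (chi A) \<le> folner_density A"
proof (rule dense_le)
  fix \<alpha> assume \<alpha>: "\<alpha> < blinfun_apply \<nu> (chi A)"
  obtain D :: "('a set set \<times> 'a set) set" and le F where fn: "folner_net D le F"
    and cl: "cluster_point_of_net strong_operator_topology D le (\<lambda>a. mean (F a)) \<nu>"
    using assms(2) by (auto simp: LIM0_def LIM0_on_def)
  have dir: "directed_set D le" and F: "\<And>b. b \<in> D \<Longrightarrow> F b \<in> Pf"
    using fn by (auto simp: folner_net_def)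
  \<comment> \<open>The half-line above \<alpha> is an open neighbourhood of
    \<open>\<nu> (chi A)\<close>, so the means enter it beyond every index.\<close>
  have far: "\<exists>b\<in>D. le a b \<and> \<alpha> * real (card (F b)) \<le> real (card (A \<inter> F b))" if "a \<in> D" for a
  proof -
    obtain b where b: "b \<in> D" "le a b" "blinfun_apply (mean (F b)) (chi A) \<in> {\<alpha><..}"
      using cluster_point_of_net_apply[OF cl open_greaterThan _ \<open>a \<in> D\<close>] \<alpha> by (metis greaterThan_iff)
    have "finite (F b)" "card (F b) > 0"
      using F[OF b(1)] by (auto simp: Pf_def card_gt_0_iff)
    with b show ?thesis
      by (intro bexI[of _ b]) (auto simp: mean_chi pos_less_divide_eq)
  qed
  show "\<alpha> \<le> folner_density A"
  \<comment> \<open>The supremum ranges over levels in [0,1] only; a negative \<alpha> lies below it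
    by nonnegativity of the density.\<close>
  proof (cases "0 \<le> \<alpha>")
    case False
    then show ?thesis using folner_density_nonneg[OF assms(1), of A] by simp
  next
    case True
    show ?thesis
    proof (rule le_folner_density[OF True])
      obtain a where "a \<in> D" using dir by (auto simp: directed_set_def)
      from far[OF this] obtain b where
        b: "b \<in> D" "\<alpha> * real (card (F b)) \<le> real (card (A \<inter> F b))" by blast
      have "finite (F b)" "card (F b) > 0"
        using F[OF b(1)] by (auto simp: Pf_def card_gt_0_iff)
      then have "real (card (A \<inter> F b)) \<le> real (card (F b))"
        by (simp add: card_mono)
      with b(2) have "\<alpha> * real (card (F b)) \<le> 1 * real (card (F b))"
        by linarith
      then show "\<alpha> \<le> 1"
        using \<open>card (F b) > 0\<close> by (intro mult_right_le_imp_le[of \<alpha> "real (card (F b))" 1]) auto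
    next
      show "density_level A \<alpha>"
        unfolding density_level_def
      proof (intro ballI allI impI)
        fix H :: "'a set" and \<epsilon> :: real
        assume "H \<in> Pf" "\<epsilon> > 0"
        then have "finite H" by (simp add: Pf_def)
        obtain a where a: "a \<in> D" "\<And>b s. b \<in> D \<Longrightarrow> le a b \<Longrightarrow> s \<in> H \<Longrightarrow>
            real (card (F b - (*) s ` F b)) < \<epsilon> * real (card (F b))"
          using folner_net_eventually[OF fn \<open>finite H\<close> \<open>\<epsilon> > 0\<close>] by blast
        \<comment> \<open>The Folner estimate holds everywhere beyond \<open>a\<close>, the density
          estimate at some index beyond \<open>a\<close>; this \<open>b\<close> satisfies
          both.\<close>
        from far[OF a(1)] obtain b where
          "b \<in> D" "le a b" "\<alpha> * real (card (F b)) \<le> real (card (A \<inter> F b))" by blast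
        with a(2) F show "\<exists>K\<in>Pf. (\<forall>s\<in>H. real (card (K - (*) s ` K)) < \<epsilon> * real (card K)) \<and>
            \<alpha> * real (card K) \<le> real (card (A \<inter> K))"
          by blast
      qed
    qed
  qed
qed

lemma LIM0_chi_ge_ex:
  fixes A :: "'a::semigroup_mult set"
  assumes "SFC TYPE('a)"
  obtains \<nu> where "\<nu> \<in> LIM0" "folner_density A \<le> blinfun_apply \<nu> (chi A)"
proof -
  define d where "d = folner_density A"
  define D :: "('a set \<times> nat) set" where "D = Pf \<times> UNIV"
  define le where "le = (\<lambda>(p :: 'a set \<times> nat) q. fst p \<subseteq> fst q \<and> snd p \<le> snd q)"
  \<comment> \<open>One tolerance serves both as the Folner bound and as the permitted loss of
    density, so both vanish along the net.\<close>
  define e where "e = (\<lambda>p :: 'a set \<times> nat. 1 / real (Suc (snd p)))"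
  have e_pos: "e p > 0" for p by (simp add: e_def)
  have e_mono: "e q \<le> e p" if "le p q" for p q
    using that by (auto simp: e_def le_def frac_le)
  have "\<exists>K\<in>Pf. (\<forall>s\<in>fst p. real (card (K - (*) s ` K)) < e p * real (card K)) \<and>
      (d - e p) * real (card K) \<le> real (card (A \<inter> K))" if "p \<in> D" for p
  proof -
    have "density_level A (d - e p)"
      by (rule density_level_less_folner_density[OF assms]) (simp add: d_def e_pos)
    moreover have "fst p \<in> Pf" using that by (auto simp: D_def)
    ultimately show ?thesis
      using e_pos[of p] unfolding density_level_def by blast
  qed
  then obtain F where F: "\<And>p. p \<in> D \<Longrightarrow> F p \<in> Pf"
    and F1: "\<And>p s. p \<in> D \<Longrightarrow> s \<in> fst p \<Longrightarrow> real (card (F p - (*) s ` F p)) < e p * real (card (F p))"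
    and F2: "\<And>p. p \<in> D \<Longrightarrow> (d - e p) * real (card (F p)) \<le> real (card (A \<inter> F p))"
    by metis
  have fin: "finite (F p)" "card (F p) > 0" if "p \<in> D" for p
    using F[OF that] by (auto simp: Pf_def card_gt_0_iff)
  have dir: "directed_set D le"
    unfolding directed_set_def
  proof (intro conjI ballI impI)
    show "D \<noteq> {}" by (auto simp: D_def Pf_def)
  next
    fix p q assume "p \<in> D" "q \<in> D"
    then show "\<exists>r\<in>D. le p r \<and> le q r"
      by (intro bexI[of _ "(fst p \<union> fst q, max (snd p) (snd q))"]) (auto simp: D_def le_def Pf_def)
  qed (auto simp: le_def)
  \<comment> \<open>Since \<open>le\<close> enlarges the finite set and decreases \<open>e\<close>,
    both properties of such a \<open>p\<close> persist at every later index.\<close>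
  have small: "\<exists>p\<in>D. s \<in> fst p \<and> e p < r" if r: "r > 0" for s and r :: real
  proof -
    obtain n where "inverse (real (Suc n)) < r" using reals_Archimedean[OF r] by blast
    then show ?thesis
      by (intro bexI[of _ "({s}, n)"]) (auto simp: D_def Pf_def e_def inverse_eq_divide)
  qed
  have fn: "folner_net D le F"
    unfolding folner_net_def
  proof (intro conjI dir allI ballI F)
    fix s :: 'a
    show "((\<lambda>p. real (card (F p - (*) s ` F p)) / real (card (F p))) \<longlongrightarrow> 0) (tails D le)"
      unfolding tendsto_iff
    proof (intro allI impI)
      fix r :: real assume "r > 0"
      then obtain p where p: "p \<in> D" "s \<in> fst p" "e p < r" using small by blast
      have "real (card (F q - (*) s ` F q)) / real (card (F q)) < r" if q: "q \<in> D" "le p q" for q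
      proof -
        have "s \<in> fst q" using p(2) q(2) by (auto simp: le_def)
        with F1[OF q(1)] fin[OF q(1)]
        have "real (card (F q - (*) s ` F q)) / real (card (F q)) < e q"
          by (simp add: pos_divide_less_eq)
        with e_mono[OF q(2)] p(3) show ?thesis by linarith
      qed
      then show "eventually (\<lambda>p. dist (real (card (F p - (*) s ` F p)) / real (card (F p))) 0 < r) (tails D le)"
        unfolding eventually_tails[OF dir] by (intro bexI[OF _ p(1)]) simp
    qed
  qed
  obtain \<nu> where cl: "cluster_point_of_net strong_operator_topology D le (\<lambda>p. mean (F p)) \<nu>"
    using cluster_point_of_net_ex[OF dir, of "\<lambda>p. mean (F p)"] abs_mean_le by blast
  \<comment> \<open>The index type here differs from the one fixed in \<open>LIM0\<close>, so the
    net is transferred by \<open>LIM0_on_subset_LIM0\<close>.\<close>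
  have "\<nu> \<in> LIM0"
    using fn cl LIM0_on_subset_LIM0[where 'i = "'a set \<times> nat"] by (auto simp: LIM0_on_def)
  moreover have "d \<le> blinfun_apply \<nu> (chi A)"
  proof (rule ccontr)
    assume "\<not> d \<le> blinfun_apply \<nu> (chi A)"
    \<comment> \<open>Beyond an index with \<open>e p < d - c\<close> every mean of
      \<open>chi A\<close> exceeds \<open>c\<close>, whereas the cluster point forces a value below
      \<open>c\<close> there.\<close>
    then obtain c where c: "blinfun_apply \<nu> (chi A) < c" "c < d"
      using dense[of "blinfun_apply \<nu> (chi A)" d] by auto
    then obtain p where p: "p \<in> D" "e p < d - c" using small[of "d - c"] by (metis diff_gt_0_iff_gt)
    obtain q where q: "q \<in> D" "le p q" "blinfun_apply (mean (F q)) (chi A) \<in> {..<c}"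
      using cluster_point_of_net_apply[OF cl open_lessThan _ p(1)] c(1) by (metis lessThan_iff)
    have "d - e q \<le> blinfun_apply (mean (F q)) (chi A)"
      using F2[OF q(1)] fin[OF q(1)] by (simp add: mean_chi pos_le_divide_eq)
    with q(3) e_mono[OF q(2)] p(2) show False by simp
  qed
  ultimately show thesis using that by (simp add: d_def)
qed

theorem theorem1p14:
  fixes A :: "'a::semigroup_mult set"
  assumes "SFC TYPE('a)"
  shows "folner_density A \<in> {blinfun_apply \<nu> (chi A) | \<nu>. \<nu> \<in> LIM0} \<and>
    (\<forall>x \<in> {blinfun_apply \<nu> (chi A) | \<nu>. \<nu> \<in> LIM0}. x \<le> folner_density A)"
proof -
  obtain \<nu> where "\<nu> \<in> LIM0" "folner_density A \<le> blinfun_apply \<nu> (chi A)"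
    using LIM0_chi_ge_ex[OF assms] .
  \<comment> \<open>The upper bound applied to this \<nu> gives equality, so the density is
    attained.\<close>
  with LIM0_chi_le[OF assms] show ?thesis
    by (auto intro: order_antisym)
qed

end
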